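(* Let $\chi_3$ be the set of all normal matrices $X\in\mathbb{C}^{9\times9}$ of the form $X=A\otimes I_3+I_3\otimes B$, where $A,B\in\mathbb{C}^{3\times3}$ satisfy $\operatorname{Tr}A=\operatorname{Tr}B=0$ and $\operatorname{Tr}A^\dagger A+\operatorname{Tr}B^\dagger B=\frac13$. For $X\in\chi_3$ let $\sigma_1\ge\sigma_2$ denote the two largest singular values of $X$. Then $$\frac59\le\sup_{X\in\chi_3}(\sigma_1^2+\sigma_2^2)\le\frac23.$$
   Context: $A^\dagger$ denotes the conjugate transpose of $A$, $\otimes$ the Kronecker product, and $I_3$ the $3\times3$ identity matrix. Singular values are counted with multiplicity. *)

theory Defs
  imports
    "Jordan_Normal_Form.Char_Poly"
    "Jordan_Normal_Form.Schur_Decomposition"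
    "HOL-Library.Extended_Real"
begin

definition mat_trace :: "'a :: comm_monoid_add mat \<Rightarrow> 'a" where
  "mat_trace A = (\<Sum>i<dim_row A. A $$ (i, i))"

definition kronecker :: "'a :: times mat \<Rightarrow> 'a mat \<Rightarrow> 'a mat" where
  "kronecker A B = mat (dim_row A * dim_row B) (dim_col A * dim_col B)
     (\<lambda>(i, j). A $$ (i div dim_row B, j div dim_col B) * B $$ (i mod dim_row B, j mod dim_col B))"

definition normal_mat :: "complex mat \<Rightarrow> bool" where
  "normal_mat X \<longleftrightarrow> square_mat X \<and> X * mat_adjoint X = mat_adjoint X * X"

text \<open>
  The singular values of \<open>X\<close> in decreasing order, repeated according to multiplicity: the square
  roots of the eigenvalues of the conjugate transpose of \<open>X\<close> times \<open>X\<close>. These eigenvalues are the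
  roots, with multiplicity, of the characteristic polynomial; they are real and nonnegative, so
  that taking the real part only changes the type. For \<open>n\<close> columns the list has length \<open>n\<close>, and the
  largest singular value has index \<open>0\<close>.
\<close>

definition singular_values :: "complex mat \<Rightarrow> real list" where
  "singular_values X = rev (sorted_list_of_multiset
     (image_mset (\<lambda>z. sqrt (Re z)) (proots (char_poly (mat_adjoint X * X)))))"

definition chi3 :: "complex mat set" where
  "chi3 = {X. X \<in> carrier_mat 9 9 \<and> normal_mat X \<and>
     (\<exists>A \<in> carrier_mat 3 3. \<exists>B \<in> carrier_mat 3 3.
        X = kronecker A (1\<^sub>m 3) + kronecker (1\<^sub>m 3) B \<and>
        mat_trace A = 0 \<and> mat_trace B = 0 \<and>
        mat_trace (mat_adjoint A * A) + mat_trace (mat_adjoint B * B) = 1 / 3)}"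

end

theory Submission
  imports
    Defs
    "Jordan_Normal_Form.Jordan_Normal_Form_Existence"
    "Jordan_Normal_Form.Jordan_Normal_Form_Uniqueness"
begin

text \<open>
  If \<open>X = A \<otimes> I + I \<otimes> B\<close> is normal, then \<open>A\<close> and \<open>B\<close> are normal, so the
  singular values of \<open>X\<close> are the moduli \<open>|a\<^sub>i + b\<^sub>j|\<close> for the eigenvalues \<open>a\<^sub>i\<close> of \<open>A\<close> and \<open>b\<^sub>j\<close> of \<open>B\<close>.
  Two of them in different rows and columns have squares adding up to at most
  \<open>2 (\<Sum>|a\<^sub>i|\<^sup>2 + \<Sum>|b\<^sub>j|\<^sup>2) = 2/3\<close>. For two in the same row, \<open>\<Sum>a\<^sub>i = \<Sum>b\<^sub>j = 0\<close> gives the same bound.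
  The value \<open>5/9\<close> is attained by diagonal matrices with eigenvalues proportional to \<open>4, -2, -2\<close> and
  \<open>1, 1, -2\<close>, the optimum among pairs in the same row.

  Normal matrices are diagonalized without unitary matrices: \<open>ker N\<^sup>2 = ker N\<close> for normal \<open>N\<close>, hence all
  Jordan blocks have size 1, and an eigenvector of \<open>A\<close> for \<open>a\<close> is one of the adjoint for the conjugate
  of \<open>a\<close>, so that one basis diagonalizes both.
\<close>

section \<open>Diagonal matrices, conjugation and the conjugate transpose\<close>

lemma mat_diag_dims [simp]:
  "dim_row (mat_diag n d) = n" "dim_col (mat_diag n d) = n"
  by (simp_all add: mat_diag_def)

lemma mat_diag_index [simp]:
  "i < n \<Longrightarrow> j < n \<Longrightarrow> mat_diag n d $$ (i, j) = (if i = j then d j else 0)"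
  by (simp add: mat_diag_def)

text \<open>The inner factor \<open>Q * P\<close> cancels. This is how products such as
  \<open>mat_adjoint X * X\<close> are computed in an eigenbasis that need not be
  orthonormal.\<close>

lemma conj_mat_mult:
  fixes C D P Q :: "'a :: comm_ring_1 mat"
  assumes "P \<in> carrier_mat n n" "Q \<in> carrier_mat n n" "Q * P = 1\<^sub>m n"
    and "C \<in> carrier_mat n n" "D \<in> carrier_mat n n"
  shows "(P * C * Q) * (P * D * Q) = P * (C * D) * Q"
proof -
  have "(P * C * Q) * (P * D * Q) = P * C * (Q * P) * D * Q"
    using assms(1,2,4,5) by (simp add: assoc_mult_mat[of _ n n _ n _ n])
  then show ?thesis
    using assms by (simp add: assoc_mult_mat[of _ n n _ n _ n])
qed

lemma mat_adjoint_dim [simp]: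
  "dim_row (mat_adjoint A) = dim_col A" "dim_col (mat_adjoint A) = dim_row A"
  by (simp_all add: mat_adjoint_def)

lemma mat_adjoint_carrier [simp]:
  "A \<in> carrier_mat n m \<Longrightarrow> mat_adjoint A \<in> carrier_mat m n"
  by (auto simp: mat_adjoint_def mat_of_rows_def)

lemma mat_adjoint_index:
  fixes A :: "complex mat"
  assumes "A \<in> carrier_mat n m" "i < m" "j < n"
  shows "mat_adjoint A $$ (i, j) = cnj (A $$ (j, i))"
  using assms by (auto simp: mat_adjoint_def mat_of_rows_def)

lemma mat_adjoint_adjoint:
  fixes A :: "complex mat"
  assumes "A \<in> carrier_mat n m"
  shows "mat_adjoint (mat_adjoint A) = A"
proof -
  note A' = mat_adjoint_carrier[OF assms]
  show ?thesis
    using assms A' mat_adjoint_carrier[OF A']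
    by (intro eq_matI) (auto simp: mat_adjoint_index[OF A'] mat_adjoint_index[OF assms])
qed

lemma mat_adjoint_add:
  fixes A B :: "complex mat"
  assumes "A \<in> carrier_mat n m" "B \<in> carrier_mat n m"
  shows "mat_adjoint (A + B) = mat_adjoint A + mat_adjoint B"
proof -
  have AB: "A + B \<in> carrier_mat n m" using assms by simp
  show ?thesis
    using assms mat_adjoint_carrier[OF AB] mat_adjoint_carrier[OF assms(1)] mat_adjoint_carrier[OF assms(2)]
    by (intro eq_matI)
      (auto simp: mat_adjoint_index[OF AB] mat_adjoint_index[OF assms(1)] mat_adjoint_index[OF assms(2)])
qed

lemma mat_adjoint_mat_diag:
  "mat_adjoint (mat_diag n d :: complex mat) = mat_diag n (\<lambda>i. cnj (d i))"
proof -
  have D: "mat_diag n d \<in> carrier_mat n n" by simp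
  show ?thesis
    using mat_adjoint_carrier[OF D]
    by (intro eq_matI) (auto simp: mat_adjoint_index[OF D])
qed

lemma mat_adjoint_inner:
  fixes A :: "complex mat"
  assumes A: "A \<in> carrier_mat n m" and v: "v \<in> carrier_vec m" and w: "w \<in> carrier_vec n"
  shows "(A *\<^sub>v v) \<bullet>c w = v \<bullet>c (mat_adjoint A *\<^sub>v w)"
proof -
  note A' = mat_adjoint_carrier[OF A]
  have "(A *\<^sub>v v) \<bullet>c w = (\<Sum>i<n. \<Sum>j<m. A $$ (i, j) * v $ j * cnj (w $ i))"
    using A v w by (auto simp: scalar_prod_def sum_distrib_right atLeast0LessThan intro!: sum.cong)
  also have "\<dots> = (\<Sum>j<m. \<Sum>i<n. A $$ (i, j) * v $ j * cnj (w $ i))"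
    by (rule sum.swap)
  also have "\<dots> = v \<bullet>c (mat_adjoint A *\<^sub>v w)"
    using A A' v w
    by (auto simp: scalar_prod_def sum_distrib_left atLeast0LessThan mat_adjoint_index[OF A] ac_simps
        intro!: sum.cong)
  finally show ?thesis .
qed

section \<open>Kernels of normal matrices\<close>

text \<open>Moving one adjoint across the inner product turns the squared norm of
  \<open>mat_adjoint M *\<^sub>v v\<close> into the product of \<open>v\<close> with
  \<open>M * mat_adjoint M\<close> applied to \<open>v\<close>; normality swaps the factors, and
  \<open>M *\<^sub>v v\<close> vanishes.\<close>

lemma normal_kernel_adjoint:
  assumes M: "M \<in> carrier_mat n n" and nM: "normal_mat M" and v: "v \<in> carrier_vec n"
    and 0: "M *\<^sub>v v = 0\<^sub>v n"
  shows "mat_adjoint M *\<^sub>v v = 0\<^sub>v n"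
proof -
  note M' = mat_adjoint_carrier[OF M]
  have w: "mat_adjoint M *\<^sub>v v \<in> carrier_vec n" using M' v by auto
  have "(mat_adjoint M *\<^sub>v v) \<bullet>c (mat_adjoint M *\<^sub>v v) = v \<bullet>c (M *\<^sub>v (mat_adjoint M *\<^sub>v v))"
    using mat_adjoint_inner[OF M' v w] by (simp add: mat_adjoint_adjoint[OF M])
  also have "M *\<^sub>v (mat_adjoint M *\<^sub>v v) = mat_adjoint M *\<^sub>v (M *\<^sub>v v)"
    using nM v by (simp add: normal_mat_def flip: assoc_mult_mat_vec[OF M M' v] assoc_mult_mat_vec[OF M' M v])
  also have "\<dots> = 0\<^sub>v n" unfolding 0 using M' by (intro eq_vecI) (auto simp: scalar_prod_def)
  finally have "(mat_adjoint M *\<^sub>v v) \<bullet>c (mat_adjoint M *\<^sub>v v) = 0" using v by simp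
  with conjugate_square_eq_0_vec[OF w] show ?thesis by simp
qed

text \<open>If \<open>M * M\<close> kills \<open>v\<close>, then \<open>M *\<^sub>v v\<close> lies
  in the kernel of \<open>M\<close>, hence in that of the adjoint, so its squared norm, the inner
  product of \<open>v\<close> with \<open>mat_adjoint M *\<^sub>v (M *\<^sub>v v)\<close>, is
  zero.\<close>

lemma normal_kernel_square:
  assumes M: "M \<in> carrier_mat n n" and nM: "normal_mat M"
  shows "mat_kernel (M * M) = mat_kernel M"
proof
  show "mat_kernel M \<subseteq> mat_kernel (M * M)" by (rule mat_kernel_mult_subset[OF M M])
  show "mat_kernel (M * M) \<subseteq> mat_kernel M"
  proof
    fix v assume "v \<in> mat_kernel (M * M)"
    from mat_kernelD[OF mult_carrier_mat[OF M M] this]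
    have v: "v \<in> carrier_vec n" and "M *\<^sub>v (M *\<^sub>v v) = 0\<^sub>v n" using M by auto
    moreover have Mv: "M *\<^sub>v v \<in> carrier_vec n" using M v by auto
    ultimately have "mat_adjoint M *\<^sub>v (M *\<^sub>v v) = 0\<^sub>v n"
      by (intro normal_kernel_adjoint[OF M nM])
    then have "(M *\<^sub>v v) \<bullet>c (M *\<^sub>v v) = 0"
      using mat_adjoint_inner[OF M v Mv] v by simp
    with conjugate_square_eq_0_vec[OF Mv] have "M *\<^sub>v v = 0\<^sub>v n" by simp
    with M v show "v \<in> mat_kernel M" by (intro mat_kernelI)
  qed
qed

text \<open>Since \<open>char_matrix M e\<close> is \<open>M\<close> minus \<open>e\<close> times
  the identity, this carries the two kernel lemmas from the eigenvalue 0 to an arbitrary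
  \<open>e\<close>.\<close>

lemma normal_char_matrix:
  assumes M: "M \<in> carrier_mat n n" and nM: "normal_mat M"
  shows "normal_mat (char_matrix M e)"
    and "mat_adjoint (char_matrix M e) = char_matrix (mat_adjoint M) (cnj e)"
proof -
  note M' = mat_adjoint_carrier[OF M]
  note C = char_matrix_closed[OF M, of e]
  note C' = char_matrix_closed[OF M', of "cnj e"]
  show *: "mat_adjoint (char_matrix M e) = char_matrix (mat_adjoint M) (cnj e)"
    using M M' mat_adjoint_carrier[OF C] C'
    by (intro eq_matI; simp add: mat_adjoint_index[OF C]) (auto simp: char_matrix_def mat_adjoint_index[OF M])
  \<comment> \<open>Apart from \<open>A * B\<close>, the expansion is symmetric under exchanging
    \<open>(A, a)\<close> with \<open>(B, b)\<close>, so the shifted matrices commute as soon as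
    \<open>A\<close> and \<open>B\<close> do.\<close>
  have eq: "char_matrix A a * char_matrix B b = A * B + (- b) \<cdot>\<^sub>m A + (- a) \<cdot>\<^sub>m B + (a * b) \<cdot>\<^sub>m 1\<^sub>m n"
    if A: "A \<in> carrier_mat n n" and B: "B \<in> carrier_mat n n" for A B :: "complex mat" and a b
  proof -
    have "char_matrix A a * char_matrix B b
      = (A * B + A * ((- b) \<cdot>\<^sub>m 1\<^sub>m n)) + (((- a) \<cdot>\<^sub>m 1\<^sub>m n) * B + ((- a) \<cdot>\<^sub>m 1\<^sub>m n) * ((- b) \<cdot>\<^sub>m 1\<^sub>m n))"
      using A B unfolding char_matrix_def
      by (subst add_mult_distrib_mat[of _ n n _ _ n], simp_all)
         (subst mult_add_distrib_mat[of _ n n _ n], simp_all)+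
    also have "A * ((- b) \<cdot>\<^sub>m 1\<^sub>m n) = (- b) \<cdot>\<^sub>m A"
      using A by (subst mult_smult_distrib[of _ n n _ n]) auto
    also have "((- a) \<cdot>\<^sub>m 1\<^sub>m n) * B = (- a) \<cdot>\<^sub>m B"
      using B by (subst mult_smult_assoc_mat[of _ n n _ n]) auto
    also have "((- a) \<cdot>\<^sub>m 1\<^sub>m n) * ((- b) \<cdot>\<^sub>m 1\<^sub>m n) = (a * b) \<cdot>\<^sub>m 1\<^sub>m n"
      by (subst mult_smult_assoc_mat[of _ n n _ n], simp, simp, intro eq_matI) simp_all
    finally show ?thesis using A B by (intro eq_matI) auto
  qed
  show "normal_mat (char_matrix M e)"
    unfolding normal_mat_def *
  proof
    show "square_mat (char_matrix M e)" using C by auto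
    show "char_matrix M e * char_matrix (mat_adjoint M) (cnj e) = char_matrix (mat_adjoint M) (cnj e) * char_matrix M e"
      using nM M M' unfolding normal_mat_def eq[OF M M'] eq[OF M' M]
      by (intro eq_matI) auto
  qed
qed

section \<open>Diagonalization through the Jordan normal form\<close>

lemma jordan_matrix_blocks_1:
  assumes "\<forall>p \<in> set n_as. fst p = 1"
  shows "jordan_matrix n_as = mat_diag (length n_as) (\<lambda>i. snd (n_as ! i))"
  using assms
proof (induction n_as)
  case Nil
  then show ?case by (intro eq_matI) (auto simp: mat_diag_def)
next
  case (Cons p n_as)
  obtain a where p: "p = (1, a)" using Cons.prems by (cases p) auto
  have len: "sum_list (map fst n_as) = length n_as"
    using Cons.prems by (induction n_as) auto
  show ?case
    unfolding p jordan_matrix_Cons len using Cons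
    by (intro eq_matI) (auto simp: mat_diag_def nth_Cons')
qed

lemma kernel_dim_cong:
  fixes A B :: "'a :: field mat"
  assumes "A \<in> carrier_mat n m" "B \<in> carrier_mat n m" "mat_kernel A = mat_kernel B"
  shows "kernel_dim A = kernel_dim B"
  using assms by (simp add: kernel_dim_def)

text \<open>The kernel of the k-th power of \<open>char_matrix M e\<close> has dimension the sum of
  \<open>min k s\<close> over the sizes \<open>s\<close> of the blocks for \<open>e\<close>. The
  kernels for the powers 1 and 2 agree, which leaves no room for a block of size 2 or more.\<close>

lemma normal_jordan_blocks:
  assumes M: "M \<in> carrier_mat n n" and nM: "normal_mat M" and nf: "jordan_nf M n_as"
  shows "\<forall>p \<in> set n_as. fst p = 1"
proof
  fix p assume p: "p \<in> set n_as"
  obtain k e where ke: "p = (k, e)" by (cases p)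
  let ?C = "char_matrix M e"
  let ?ks = "map fst [(n, e') \<leftarrow> n_as. e' = e]"
  have C: "?C \<in> carrier_mat n n" using M by simp
  have pow: "?C ^\<^sub>m 2 = ?C * ?C" "?C ^\<^sub>m 1 = ?C"
    using C by (simp_all add: numeral_2_eq_2)
  have "kernel_dim (?C * ?C) = kernel_dim ?C"
    using C normal_kernel_square[OF C normal_char_matrix(1)[OF M nM]]
    by (intro kernel_dim_cong[of _ n n]) auto
  then have "dim_gen_eigenspace M e 2 = dim_gen_eigenspace M e 1"
    unfolding dim_gen_eigenspace_def pow .
  then have eq: "(\<Sum>k\<leftarrow>?ks. min 2 k) = (\<Sum>k\<leftarrow>?ks. min 1 k)"
    by (simp only: dim_gen_eigenspace[OF nf])
  \<comment> \<open>Each summand on the right is at most the corresponding one on the left, so equal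
    sums force equal summands.\<close>
  have "\<forall>k \<in> set ks. min 2 k = min 1 k"
    if "(\<Sum>k\<leftarrow>ks. min 2 k) = (\<Sum>k\<leftarrow>ks. min 1 k)" for ks :: "nat list"
    using that
  proof (induction ks)
    case (Cons k ks)
    have "(\<Sum>k\<leftarrow>ks. min 1 k) \<le> (\<Sum>k\<leftarrow>ks. min 2 k)"
      by (intro sum_list_mono) auto
    moreover have "min 1 k \<le> min 2 k" by simp
    ultimately have "min 2 k = min 1 k \<and> (\<Sum>k\<leftarrow>ks. min 2 k) = (\<Sum>k\<leftarrow>ks. min 1 k)"
      using Cons.prems by simp
    with Cons.IH show ?case by auto
  qed simp
  moreover have "k \<in> set ?ks" using p by (force simp: ke)
  ultimately have "min 2 k = min 1 k" using eq by blast
  moreover have "k \<noteq> 0" using nf p ke by (force simp: jordan_nf_def)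
  ultimately show "fst p = 1" by (simp add: ke)
qed

text \<open>What replaces unitarity is that one pair \<open>P\<close>, \<open>Q\<close> diagonalizes
  both \<open>M\<close> and its adjoint.\<close>

lemma normal_mat_diagonalization:
  assumes M: "M \<in> carrier_mat n n" and nM: "normal_mat M"
  obtains P Q d where "P \<in> carrier_mat n n" "Q \<in> carrier_mat n n" "P * Q = 1\<^sub>m n" "Q * P = 1\<^sub>m n"
    "M = P * mat_diag n d * Q" "mat_adjoint M = P * mat_diag n (\<lambda>i. cnj (d i)) * Q"
proof -
  note M' = mat_adjoint_carrier[OF M]
  obtain es where "char_poly M = (\<Prod>e\<leftarrow>es. [:- e, 1:])"
    using char_poly_factorized[OF M] by auto
  with jordan_nf_exists[OF M] obtain n_as where nf: "jordan_nf M n_as" by blast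
  define d where "d = (\<lambda>i. snd (n_as ! i))"
  have "jordan_matrix n_as = mat_diag (length n_as) d"
    unfolding d_def by (rule jordan_matrix_blocks_1[OF normal_jordan_blocks[OF M nM nf]])
  with nf obtain P Q where "similar_mat_wit M (mat_diag (length n_as) d) P Q"
    by (auto simp: jordan_nf_def similar_mat_def)
  note sim = similar_mat_witD2[OF M this]
  have len: "length n_as = n" using sim(5) by auto
  note D = mat_diag_dim[of n d] and D' = mat_diag_dim[of n "\<lambda>i. cnj (d i)"]
  have P: "P \<in> carrier_mat n n" and Q: "Q \<in> carrier_mat n n" and PQ: "P * Q = 1\<^sub>m n" and QP: "Q * P = 1\<^sub>m n"
    and M_eq: "M = P * mat_diag n d * Q"
    using sim by (simp_all add: len)
  have "M * P = P * mat_diag n d * (Q * P)"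
    unfolding M_eq using P Q D by (intro assoc_mult_mat[of _ n n _ n]) auto
  then have MP: "M * P = P * mat_diag n d" using P D QP by simp
  \<comment> \<open>Compared column by column: column \<open>i\<close> of \<open>P\<close> lies in
    the kernel of \<open>char_matrix M (d i)\<close>, which is normal, hence also in the kernel of
    its adjoint, so it is an eigenvector of \<open>mat_adjoint M\<close> for
    \<open>cnj (d i)\<close>.\<close>
  have M'P: "mat_adjoint M * P = P * mat_diag n (\<lambda>i. cnj (d i))"
  proof (rule mat_col_eqI)
    fix i assume "i < dim_col (P * mat_diag n (\<lambda>i. cnj (d i)))"
    then have i: "i < n" using D' by auto
    have v: "col P i \<in> carrier_vec n" using P i by auto
    have col: "col (P * mat_diag n f) i = f i \<cdot>\<^sub>v col P i" for f
      using P i by (intro eq_vecI) (auto simp: mat_diag_mult_right[OF P])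
    have cm: "char_matrix A a *\<^sub>v v = A *\<^sub>v v - a \<cdot>\<^sub>v v"
      if "A \<in> carrier_mat n n" "v \<in> carrier_vec n" for A a and v :: "complex vec"
      using that unfolding char_matrix_def
      by (intro eq_vecI) (auto simp: add_scalar_prod_distrib[of _ n])
    have "M *\<^sub>v col P i = d i \<cdot>\<^sub>v col P i"
      using col_mult2[OF M P i] by (simp add: MP col)
    then have "char_matrix M (d i) *\<^sub>v col P i = 0\<^sub>v n"
      using v by (simp add: cm[OF M v])
    from normal_kernel_adjoint[OF char_matrix_closed[OF M] normal_char_matrix(1)[OF M nM] v this]
    have *: "mat_adjoint M *\<^sub>v col P i - cnj (d i) \<cdot>\<^sub>v col P i = 0\<^sub>v n"
      by (simp add: normal_char_matrix(2)[OF M nM] cm[OF M' v])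
    have "mat_adjoint M *\<^sub>v col P i = cnj (d i) \<cdot>\<^sub>v col P i"
    proof (rule eq_vecI)
      fix j assume "j < dim_vec (cnj (d i) \<cdot>\<^sub>v col P i)"
      then have j: "j < n" using P by auto
      then show "(mat_adjoint M *\<^sub>v col P i) $ j = (cnj (d i) \<cdot>\<^sub>v col P i) $ j"
        using arg_cong[OF *, of "\<lambda>u. u $ j"] M' P
          by (auto simp del: index_mult_mat_vec)
    qed (use M' P in auto)
    then show "col (mat_adjoint M * P) i = col (P * mat_diag n (\<lambda>i. cnj (d i))) i"
      using col_mult2[OF M' P i] by (simp add: col)
  qed (use M' P D' in auto)
  have "mat_adjoint M = mat_adjoint M * (P * Q)" by (simp only: PQ right_mult_one_mat[OF M'])
  also have "\<dots> = mat_adjoint M * P * Q" using assoc_mult_mat[OF M' P Q] by simp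
  finally have "mat_adjoint M = P * mat_diag n (\<lambda>i. cnj (d i)) * Q" unfolding M'P .
  with P Q PQ QP M_eq show ?thesis by (rule that)
qed

section \<open>Kronecker products\<close>

lemma kronecker_carrier:
  "A \<in> carrier_mat n p \<Longrightarrow> B \<in> carrier_mat m r \<Longrightarrow> kronecker A B \<in> carrier_mat (n * m) (p * r)"
  by (auto simp: kronecker_def)

lemma kronecker_index:
  assumes "A \<in> carrier_mat n p" "B \<in> carrier_mat m r" "i < n * m" "j < p * r"
  shows "kronecker A B $$ (i, j) = A $$ (i div m, j div r) * B $$ (i mod m, j mod r)"
  using assms by (auto simp: kronecker_def)

lemma div_mod_less_mult:
  fixes i n m :: nat
  assumes "i < n * m"
  shows "i div m < n" "i mod m < m"
  using assms by (auto simp: less_mult_imp_div_less intro!: mod_less_divisor intro: gr0I)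

lemma mult_add_less_mult:
  fixes i k n m :: nat
  assumes "i < n" "k < m"
  shows "i * m + k < n * m"
proof -
  have "i * m + k < Suc i * m" using assms(2) by simp
  also have "\<dots> \<le> n * m" using assms(1) by (intro mult_le_mono1) simp
  finally show ?thesis .
qed

text \<open>Splits a flat Kronecker index into a block number and a position inside the block, which
  turns the inner sum of a matrix product into a double sum.\<close>

lemma sum_div_mod:
  fixes f :: "nat \<Rightarrow> nat \<Rightarrow> 'a :: comm_monoid_add"
  shows "(\<Sum>k<p * r. f (k div r) (k mod r)) = (\<Sum>a<p. \<Sum>b<r. f a b)"
proof -
  have "(\<Sum>k<p * r. f (k div r) (k mod r)) = (\<Sum>a<p. \<Sum>k\<in>{a * r..<a * r + r}. f (k div r) (k mod r))"
    by (rule sum.nat_group[symmetric])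
  also have "\<dots> = (\<Sum>a<p. \<Sum>b<r. f a b)"
  proof (rule sum.cong[OF refl])
    fix a
    have "(\<Sum>k\<in>{a * r..<a * r + r}. f (k div r) (k mod r))
        = (\<Sum>b<r. f ((b + a * r) div r) ((b + a * r) mod r))"
      using sum.shift_bounds_nat_ivl[of "\<lambda>k. f (k div r) (k mod r)" 0 "a * r" r]
      by (simp add: atLeast0LessThan add.commute)
    also have "\<dots> = (\<Sum>b<r. f a b)" by (intro sum.cong) auto
    finally show "(\<Sum>k\<in>{a * r..<a * r + r}. f (k div r) (k mod r)) = (\<Sum>b<r. f a b)" .
  qed
  finally show ?thesis .
qed

text \<open>The mixed product rule: after splitting the summation index, the double sum factors into
  the two entries.\<close>

lemma kronecker_mult:
  fixes A B C D :: "'a :: comm_ring_1 mat"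
  assumes A: "A \<in> carrier_mat n p" and C: "C \<in> carrier_mat p q"
    and B: "B \<in> carrier_mat m r" and D: "D \<in> carrier_mat r s"
  shows "kronecker A B * kronecker C D = kronecker (A * C) (B * D)"
proof (rule eq_matI)
  note AB = kronecker_carrier[OF A B] and CD = kronecker_carrier[OF C D]
  have AC: "A * C \<in> carrier_mat n q" and BD: "B * D \<in> carrier_mat m s" using assms by auto
  note R = kronecker_carrier[OF AC BD]
  fix i j assume "i < dim_row (kronecker (A * C) (B * D))" "j < dim_col (kronecker (A * C) (B * D))"
  then have i: "i < n * m" and j: "j < q * s" using R by auto
  note i' = div_mod_less_mult[OF i] and j' = div_mod_less_mult[OF j]
  have "(kronecker A B * kronecker C D) $$ (i, j) = (\<Sum>k<p * r. kronecker A B $$ (i, k) * kronecker C D $$ (k, j))"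
    using AB CD i j by (simp add: scalar_prod_def atLeast0LessThan)
  also have "\<dots> = (\<Sum>k<p * r. (A $$ (i div m, k div r) * C $$ (k div r, j div s))
      * (B $$ (i mod m, k mod r) * D $$ (k mod r, j mod s)))"
    using i j by (intro sum.cong) (simp_all add: kronecker_index[OF A B] kronecker_index[OF C D] ac_simps)
  also have "\<dots> = (\<Sum>a<p. \<Sum>b<r. (A $$ (i div m, a) * C $$ (a, j div s)) * (B $$ (i mod m, b) * D $$ (b, j mod s)))"
    by (rule sum_div_mod)
  also have "\<dots> = (A * C) $$ (i div m, j div s) * (B * D) $$ (i mod m, j mod s)"
    using A B C D i' j' by (simp add: scalar_prod_def atLeast0LessThan sum_product)
  also have "\<dots> = kronecker (A * C) (B * D) $$ (i, j)"
    by (rule kronecker_index[OF AC BD i j, symmetric])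
  finally show "(kronecker A B * kronecker C D) $$ (i, j) = kronecker (A * C) (B * D) $$ (i, j)" .
qed (use assms in \<open>simp_all add: kronecker_def\<close>)

lemma kronecker_one: "kronecker (1\<^sub>m n) (1\<^sub>m m) = (1\<^sub>m (n * m) :: 'a :: comm_ring_1 mat)"
proof (rule eq_matI)
  fix i j assume "i < dim_row (1\<^sub>m (n * m) :: 'a mat)" "j < dim_col (1\<^sub>m (n * m) :: 'a mat)"
  then have i: "i < n * m" and j: "j < n * m" by auto
  \<comment> \<open>Quotient and remainder determine the index, so a flat diagonal position is one
    that is diagonal in both factors.\<close>
  have "i = j \<longleftrightarrow> i div m = j div m \<and> i mod m = j mod m"
    by (metis div_mult_mod_eq)
  then show "kronecker (1\<^sub>m n) (1\<^sub>m m) $$ (i, j) = (1\<^sub>m (n * m) :: 'a mat) $$ (i, j)"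
    using i j div_mod_less_mult[OF i] div_mod_less_mult[OF j]
    by (auto simp: kronecker_index[of _ n n _ m m])
qed (auto simp: kronecker_def)

lemma mat_adjoint_kronecker:
  fixes A B :: "complex mat"
  assumes A: "A \<in> carrier_mat n p" and B: "B \<in> carrier_mat m r"
  shows "mat_adjoint (kronecker A B) = kronecker (mat_adjoint A) (mat_adjoint B)"
proof (rule eq_matI)
  note A' = mat_adjoint_carrier[OF A] and B' = mat_adjoint_carrier[OF B]
  note K = kronecker_carrier[OF A B]
  fix i j assume "i < dim_row (kronecker (mat_adjoint A) (mat_adjoint B))"
    "j < dim_col (kronecker (mat_adjoint A) (mat_adjoint B))"
  then have i: "i < p * r" and j: "j < n * m" using kronecker_carrier[OF A' B'] by auto
  show "mat_adjoint (kronecker A B) $$ (i, j) = kronecker (mat_adjoint A) (mat_adjoint B) $$ (i, j)"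
    using i j div_mod_less_mult[OF i] div_mod_less_mult[OF j]
    by (simp add: mat_adjoint_index[OF K] mat_adjoint_index[OF A] mat_adjoint_index[OF B]
        kronecker_index[OF A' B'] kronecker_index[OF A B])
qed (auto simp: kronecker_def)

section \<open>Kronecker sums\<close>

text \<open>Each identity takes its size from the other matrix; for 3 by 3 matrices this is exactly
  the form of \<open>X\<close> required in \<open>chi3\<close>.\<close>

definition kron_sum :: "complex mat \<Rightarrow> complex mat \<Rightarrow> complex mat" where
  "kron_sum A B = kronecker A (1\<^sub>m (dim_row B)) + kronecker (1\<^sub>m (dim_row A)) B"

lemma kron_sum_carrier:
  "A \<in> carrier_mat n n \<Longrightarrow> B \<in> carrier_mat m m \<Longrightarrow> kron_sum A B \<in> carrier_mat (n * m) (n * m)"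
  by (auto simp: kron_sum_def kronecker_def)

text \<open>By the mixed product rule the identity factors become \<open>R * S\<close> and
  \<open>P * Q\<close>, which collapse to identities again.\<close>

lemma kron_sum_conj:
  assumes C: "C \<in> carrier_mat n n" "P \<in> carrier_mat n n" "Q \<in> carrier_mat n n" "P * Q = 1\<^sub>m n"
    and D: "D \<in> carrier_mat m m" "R \<in> carrier_mat m m" "S \<in> carrier_mat m m" "R * S = 1\<^sub>m m"
  shows "kron_sum (P * C * Q) (R * D * S) = kronecker P R * kron_sum C D * kronecker Q S"
proof -
  note PR = kronecker_carrier[OF C(2) D(2)] and QS = kronecker_carrier[OF C(3) D(3)]
  have c1: "kronecker C (1\<^sub>m m) \<in> carrier_mat (n * m) (n * m)"
    and c2: "kronecker (1\<^sub>m n) D \<in> carrier_mat (n * m) (n * m)"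
    using C D by (auto intro!: kronecker_carrier)
  have PC: "P * C \<in> carrier_mat n n" and RD: "R * D \<in> carrier_mat m m" using C D by auto
  have "kronecker P R * kron_sum C D * kronecker Q S
      = kronecker P R * kronecker C (1\<^sub>m m) * kronecker Q S + kronecker P R * kronecker (1\<^sub>m n) D * kronecker Q S"
    using C D unfolding kron_sum_def
    by (simp add: mult_add_distrib_mat[OF PR c1 c2]
        add_mult_distrib_mat[OF mult_carrier_mat[OF PR c1] mult_carrier_mat[OF PR c2] QS])
  also have "kronecker P R * kronecker C (1\<^sub>m m) * kronecker Q S = kronecker (P * C * Q) (1\<^sub>m m)"
    using C D kronecker_mult[OF C(2,1) D(2) one_carrier_mat] kronecker_mult[OF PC C(3) D(2,3)]
    by simp
  also have "kronecker P R * kronecker (1\<^sub>m n) D * kronecker Q S = kronecker (1\<^sub>m n) (R * D * S)"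
    using C D kronecker_mult[OF C(2) one_carrier_mat D(2,1)] kronecker_mult[OF C(2,3) RD D(3)]
    by simp
  finally show ?thesis using C D by (simp add: kron_sum_def)
qed

lemma kron_sum_mat_diag:
  "kron_sum (mat_diag n a) (mat_diag m b) = mat_diag (n * m) (\<lambda>k. a (k div m) + b (k mod m))"
proof (rule eq_matI)
  have K: "kron_sum (mat_diag n a) (mat_diag m b) \<in> carrier_mat (n * m) (n * m)"
    by (intro kron_sum_carrier) auto
  then show "dim_row (kron_sum (mat_diag n a) (mat_diag m b)) = dim_row (mat_diag (n * m) (\<lambda>k. a (k div m) + b (k mod m)))"
    "dim_col (kron_sum (mat_diag n a) (mat_diag m b)) = dim_col (mat_diag (n * m) (\<lambda>k. a (k div m) + b (k mod m)))"
    by (auto simp: mat_diag_def)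
  fix i j assume "i < dim_row (mat_diag (n * m) (\<lambda>k. a (k div m) + b (k mod m)))"
    "j < dim_col (mat_diag (n * m) (\<lambda>k. a (k div m) + b (k mod m)))"
  then have i: "i < n * m" and j: "j < n * m" by (auto simp: mat_diag_def)
  have "i = j \<longleftrightarrow> i div m = j div m \<and> i mod m = j mod m"
    by (metis div_mult_mod_eq)
  then show "kron_sum (mat_diag n a) (mat_diag m b) $$ (i, j) = mat_diag (n * m) (\<lambda>k. a (k div m) + b (k mod m)) $$ (i, j)"
    using i j div_mod_less_mult[OF i] div_mod_less_mult[OF j]
    by (auto simp: kron_sum_def mat_diag_def kronecker_def)
qed

lemma mat_adjoint_kron_sum:
  assumes A: "A \<in> carrier_mat n n" and B: "B \<in> carrier_mat m m"
  shows "mat_adjoint (kron_sum A B) = kron_sum (mat_adjoint A) (mat_adjoint B)"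
proof -
  have one: "mat_adjoint (1\<^sub>m k :: complex mat) = 1\<^sub>m k" for k
    using mat_adjoint_mat_diag[of k "\<lambda>_. 1"] by simp
  show ?thesis
    using A B kronecker_carrier[OF A one_carrier_mat[of m]] kronecker_carrier[OF one_carrier_mat[of n] B]
    by (simp add: kron_sum_def mat_adjoint_add[of _ "n * m" "n * m"]
        mat_adjoint_kronecker[OF A one_carrier_mat] mat_adjoint_kronecker[OF one_carrier_mat B] one)
qed

section \<open>Traces, and normality of the two summands\<close>

lemma mat_trace_mult_comm:
  fixes A B :: "'a :: comm_ring_1 mat"
  assumes "A \<in> carrier_mat n m" "B \<in> carrier_mat m n"
  shows "mat_trace (A * B) = mat_trace (B * A)"
proof -
  have "mat_trace (A * B) = (\<Sum>i<n. \<Sum>j<m. A $$ (i, j) * B $$ (j, i))"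
    using assms by (simp add: mat_trace_def scalar_prod_def atLeast0LessThan)
  also have "\<dots> = (\<Sum>j<m. \<Sum>i<n. A $$ (i, j) * B $$ (j, i))"
    by (rule sum.swap)
  also have "\<dots> = mat_trace (B * A)"
    using assms by (simp add: mat_trace_def scalar_prod_def atLeast0LessThan mult.commute)
  finally show ?thesis .
qed

lemma mat_trace_conj_diag:
  assumes "P \<in> carrier_mat n n" "Q \<in> carrier_mat n n" "Q * P = 1\<^sub>m n"
  shows "mat_trace (P * mat_diag n d * Q) = (\<Sum>i<n. d i :: 'a :: comm_ring_1)"
proof -
  have "mat_trace (P * mat_diag n d * Q) = mat_trace (Q * (P * mat_diag n d))"
    using assms by (intro mat_trace_mult_comm[of _ n n]) auto
  also have "Q * (P * mat_diag n d) = mat_diag n d"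
    using assms by (simp flip: assoc_mult_mat[of Q n n P n "mat_diag n d" n])
  finally show ?thesis by (simp add: mat_trace_def mat_diag_def)
qed

text \<open>Exchanging the primed with the unprimed matrices only permutes the two middle terms, so
  these cancel when the products in both orders are compared.\<close>

lemma kron_sum_mult_index:
  assumes A: "A \<in> carrier_mat n n" "A' \<in> carrier_mat n n" and B: "B \<in> carrier_mat m m" "B' \<in> carrier_mat m m"
    and i: "i < n" "j < n" and k: "k < m" "l < m"
  shows "(kron_sum A B * kron_sum A' B') $$ (i * m + k, j * m + l)
    = (A * A') $$ (i, j) * 1\<^sub>m m $$ (k, l) + A $$ (i, j) * B' $$ (k, l) + A' $$ (i, j) * B $$ (k, l)
      + 1\<^sub>m n $$ (i, j) * (B * B') $$ (k, l)"
proof -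
  note K = kronecker_carrier[OF A(1) one_carrier_mat[of m]] kronecker_carrier[OF A(2) one_carrier_mat[of m]]
    kronecker_carrier[OF one_carrier_mat[of n] B(1)] kronecker_carrier[OF one_carrier_mat[of n] B(2)]
  have "kron_sum A B * kron_sum A' B'
    = (kronecker A (1\<^sub>m m) * kronecker A' (1\<^sub>m m) + kronecker A (1\<^sub>m m) * kronecker (1\<^sub>m n) B')
      + (kronecker (1\<^sub>m n) B * kronecker A' (1\<^sub>m m) + kronecker (1\<^sub>m n) B * kronecker (1\<^sub>m n) B')"
    using A B K
    by (simp add: kron_sum_def add_mult_distrib_mat[of _ "n * m" "n * m" _ _ "n * m"])
      (simp add: mult_add_distrib_mat[of _ "n * m" "n * m" _ "n * m"])
  also have "\<dots> = (kronecker (A * A') (1\<^sub>m m) + kronecker A B') + (kronecker A' B + kronecker (1\<^sub>m n) (B * B'))"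
    using A B
    by (simp add: kronecker_mult[of _ n n _ n _ m m _ m])
  also have "\<dots> $$ (i * m + k, j * m + l) = (A * A') $$ (i, j) * 1\<^sub>m m $$ (k, l) + A $$ (i, j) * B' $$ (k, l)
      + A' $$ (i, j) * B $$ (k, l) + 1\<^sub>m n $$ (i, j) * (B * B') $$ (k, l)"
    using A B i k mult_add_less_mult[OF i(1) k(1)] mult_add_less_mult[OF i(2) k(2)]
    by (simp add: kronecker_def)
  finally show ?thesis .
qed

text \<open>Since the mixed terms commute, the commutators of \<open>A\<close> and of \<open>B\<close> with their adjoints are opposite
  scalar matrices, and commutators have trace zero.\<close>

lemma normal_kron_sum:
  assumes A: "A \<in> carrier_mat n n" and B: "B \<in> carrier_mat m m" and N: "normal_mat (kron_sum A B)"
    and pos: "0 < n" "0 < m"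
  shows "normal_mat A" "normal_mat B"
proof -
  note A' = mat_adjoint_carrier[OF A] and B' = mat_adjoint_carrier[OF B]
  let ?A1 = "A * mat_adjoint A" and ?A2 = "mat_adjoint A * A"
  let ?B1 = "B * mat_adjoint B" and ?B2 = "mat_adjoint B * B"
  have "kron_sum A B * kron_sum (mat_adjoint A) (mat_adjoint B)
      = kron_sum (mat_adjoint A) (mat_adjoint B) * kron_sum A B"
    using N by (simp add: normal_mat_def mat_adjoint_kron_sum[OF A B])
  then have eq: "?A1 $$ (i, j) * 1\<^sub>m m $$ (k, l) + 1\<^sub>m n $$ (i, j) * ?B1 $$ (k, l)
      = ?A2 $$ (i, j) * 1\<^sub>m m $$ (k, l) + 1\<^sub>m n $$ (i, j) * ?B2 $$ (k, l)"
    if "i < n" "j < n" "k < m" "l < m" for i j k l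
    using kron_sum_mult_index[OF A A' B B' that] kron_sum_mult_index[OF A' A B' B that]
    by (simp add: algebra_simps)
  have tr: "mat_trace ?A1 = mat_trace ?A2" "mat_trace ?B1 = mat_trace ?B2"
    using mat_trace_mult_comm[OF A A'] mat_trace_mult_comm[OF B B'] by simp_all
  have diag: "?A1 $$ (i, i) - ?A2 $$ (i, i) = ?B2 $$ (k, k) - ?B1 $$ (k, k)" if "i < n" "k < m" for i k
    using eq[OF that(1) that(1) that(2) that(2)] that by (simp add: algebra_simps del: index_mult_mat)
  have B_diag: "?B1 $$ (k, k) = ?B2 $$ (k, k)" if k: "k < m" for k
  proof -
    have "(\<Sum>i<n. ?B2 $$ (k, k) - ?B1 $$ (k, k)) = (\<Sum>i<n. ?A1 $$ (i, i) - ?A2 $$ (i, i))"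
      using diag k by (intro sum.cong) auto
    also have "\<dots> = 0"
      using tr(1) A A' by (simp add: mat_trace_def sum_subtractf del: index_mult_mat(1))
    finally show ?thesis using pos by simp
  qed
  have A_diag: "?A1 $$ (i, i) = ?A2 $$ (i, i)" if "i < n" for i
    using diag[OF that pos(2)] B_diag[OF pos(2)] by simp
  have "?A1 = ?A2"
  proof (rule eq_matI)
    fix i j assume "i < dim_row ?A2" "j < dim_col ?A2"
    then have ij: "i < n" "j < n" using A by auto
    show "?A1 $$ (i, j) = ?A2 $$ (i, j)"
      using A_diag[OF ij(1)] eq[OF ij pos(2) pos(2)] ij pos
      by (cases "i = j") (simp_all del: index_mult_mat(1))
  qed (use A in auto)
  then show "normal_mat A" using A by (simp add: normal_mat_def)
  have "?B1 = ?B2"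
  proof (rule eq_matI)
    fix k l assume "k < dim_row ?B2" "l < dim_col ?B2"
    then have kl: "k < m" "l < m" using B by auto
    show "?B1 $$ (k, l) = ?B2 $$ (k, l)"
      using B_diag[OF kl(1)] eq[OF pos(1) pos(1) kl] kl pos
      by (cases "k = l") (simp_all del: index_mult_mat(1))
  qed (use B in auto)
  then show "normal_mat B" using B by (simp add: normal_mat_def)
qed

section \<open>Singular values of diagonalized matrices\<close>

text \<open>A common diagonalization of \<open>X\<close> and its adjoint makes
  \<open>mat_adjoint X * X\<close> similar to the diagonal matrix of the squared moduli, and
  similarity preserves the characteristic polynomial with its root multiplicities.\<close>

lemma singular_values_diagonalized:
  assumes P: "P \<in> carrier_mat n n" and Q: "Q \<in> carrier_mat n n" and PQ: "P * Q = 1\<^sub>m n" and QP: "Q * P = 1\<^sub>m n"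
    and X: "X = P * mat_diag n d * Q" and X': "mat_adjoint X = P * mat_diag n (\<lambda>i. cnj (d i)) * Q"
  shows "singular_values X = rev (sort (map (\<lambda>i. cmod (d i)) [0..<n]))"
proof -
  define E where "E = mat_diag n (\<lambda>i. complex_of_real ((cmod (d i))\<^sup>2))"
  have E: "E \<in> carrier_mat n n" by (simp add: E_def)
  have D: "mat_diag n d \<in> carrier_mat n n" "mat_diag n (\<lambda>i. cnj (d i)) \<in> carrier_mat n n" by auto
  \<comment> \<open>The product is rewritten as a whole, because unfolding \<open>X\<close> alone
    would also change the \<open>X\<close> inside \<open>mat_adjoint X\<close>.\<close>
  have "mat_adjoint X * X = P * (mat_diag n (\<lambda>i. cnj (d i)) * mat_diag n d) * Q"
    unfolding arg_cong2[OF X' X, of "(*)"] by (rule conj_mat_mult[OF P Q QP D(2,1)])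
  also have "mat_diag n (\<lambda>i. cnj (d i)) * mat_diag n d = E"
    by (simp add: E_def complex_norm_square mult.commute flip: of_real_power)
  finally have XX: "mat_adjoint X * X = P * E * Q" .
  have "P * E * Q \<in> carrier_mat n n" using P Q E by auto
  then have "similar_mat_wit (mat_adjoint X * X) E P Q"
    using P Q E PQ QP by (intro similar_mat_witI[of _ _ n]) (auto simp: XX)
  then have "char_poly (mat_adjoint X * X) = char_poly E"
    by (intro char_poly_similar) (auto simp: similar_mat_def)
  also have "\<dots> = (\<Prod>a\<leftarrow>diag_mat E. [:- a, 1:])"
    by (rule char_poly_upper_triangular[OF E]) (auto simp: E_def mat_diag_def upper_triangular_def)
  also have "diag_mat E = map (\<lambda>i. complex_of_real ((cmod (d i))\<^sup>2)) [0..<n]"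
    by (auto simp: diag_mat_def E_def mat_diag_def)
  finally have cp: "char_poly (mat_adjoint X * X)
    = (\<Prod>a\<leftarrow>map (\<lambda>i. complex_of_real ((cmod (d i))\<^sup>2)) [0..<n]. [:- a, 1:])" .
  have roots: "proots (\<Prod>a\<leftarrow>as. [:- a, 1:]) = mset as" for as :: "complex list"
  proof (induction as)
    case (Cons a as)
    have "(\<Prod>a\<leftarrow>as. [:- a, 1:]) \<noteq> 0" by (auto simp: prod_list_zero_iff)
    with Cons show ?case by (simp add: proots_mult del: mult_pCons_left)
  qed simp
  have "image_mset (\<lambda>z. sqrt (Re z)) (proots (char_poly (mat_adjoint X * X)))
      = mset (map (\<lambda>i. cmod (d i)) [0..<n])"
    unfolding cp roots mset_map image_mset.compositionality
    by (intro image_mset_cong) (simp flip: of_real_power)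
  then show ?thesis
    by (simp add: singular_values_def del: mset_map)
qed

text \<open>The Kronecker product of the two eigenbases diagonalizes the sum and its adjoint. The
  traces are expressed through the same \<open>a\<close> and \<open>b\<close>, so that the
  constraints of \<open>chi3\<close> become constraints on these eigenvalues.\<close>

lemma singular_values_kron_sum_normal:
  assumes A: "A \<in> carrier_mat n n" and B: "B \<in> carrier_mat m m" and nA: "normal_mat A" and nB: "normal_mat B"
  obtains a b where
    "singular_values (kron_sum A B) = rev (sort (map (\<lambda>k. cmod (a (k div m) + b (k mod m))) [0..<n * m]))"
    "mat_trace A = (\<Sum>i<n. a i)" "mat_trace (mat_adjoint A * A) = (\<Sum>i<n. complex_of_real ((cmod (a i))\<^sup>2))"
    "mat_trace B = (\<Sum>i<m. b i)" "mat_trace (mat_adjoint B * B) = (\<Sum>i<m. complex_of_real ((cmod (b i))\<^sup>2))"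
proof -
  have tr: "mat_trace (mat_adjoint M * M) = (\<Sum>i<k. complex_of_real ((cmod (d i))\<^sup>2))"
    if "P \<in> carrier_mat k k" "Q \<in> carrier_mat k k" "Q * P = 1\<^sub>m k" "M = P * mat_diag k d * Q"
      "mat_adjoint M = P * mat_diag k (\<lambda>i. cnj (d i)) * Q" for M P Q k d
  proof -
    have "mat_adjoint M * M = P * (mat_diag k (\<lambda>i. cnj (d i)) * mat_diag k d) * Q"
      unfolding arg_cong2[OF that(5,4), of "(*)"] using that(1-3) by (intro conj_mat_mult) auto
    then show ?thesis
      using mat_trace_conj_diag[OF that(1-3)]
      by (simp add: complex_norm_square mult.commute flip: of_real_power)
  qed
  obtain P Q a where PQ: "P \<in> carrier_mat n n" "Q \<in> carrier_mat n n" "P * Q = 1\<^sub>m n" "Q * P = 1\<^sub>m n"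
    and Aeq: "A = P * mat_diag n a * Q" "mat_adjoint A = P * mat_diag n (\<lambda>i. cnj (a i)) * Q"
    by (rule normal_mat_diagonalization[OF A nA])
  obtain R S b where RS: "R \<in> carrier_mat m m" "S \<in> carrier_mat m m" "R * S = 1\<^sub>m m" "S * R = 1\<^sub>m m"
    and Beq: "B = R * mat_diag m b * S" "mat_adjoint B = R * mat_diag m (\<lambda>i. cnj (b i)) * S"
    by (rule normal_mat_diagonalization[OF B nB])
  have "singular_values (kron_sum A B) = rev (sort (map (\<lambda>k. cmod (a (k div m) + b (k mod m))) [0..<n * m]))"
  proof (rule singular_values_diagonalized)
    show "kronecker P R \<in> carrier_mat (n * m) (n * m)" "kronecker Q S \<in> carrier_mat (n * m) (n * m)"
      using PQ RS by (auto intro: kronecker_carrier)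
    show "kronecker P R * kronecker Q S = 1\<^sub>m (n * m)" "kronecker Q S * kronecker P R = 1\<^sub>m (n * m)"
      using PQ RS by (simp_all add: kronecker_mult[of _ n n _ n _ m m _ m] kronecker_one)
    show "kron_sum A B = kronecker P R * mat_diag (n * m) (\<lambda>k. a (k div m) + b (k mod m)) * kronecker Q S"
      unfolding Aeq(1) Beq(1) using PQ RS
      by (subst kron_sum_conj) (auto simp: kron_sum_mat_diag)
    show "mat_adjoint (kron_sum A B)
        = kronecker P R * mat_diag (n * m) (\<lambda>k. cnj (a (k div m) + b (k mod m))) * kronecker Q S"
      unfolding mat_adjoint_kron_sum[OF A B] Aeq(2) Beq(2) using PQ RS
      by (subst kron_sum_conj) (auto simp: kron_sum_mat_diag)
  qed
  moreover note tr[OF PQ(1,2,4) Aeq] tr[OF RS(1,2,4) Beq]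
  moreover have "mat_trace A = (\<Sum>i<n. a i)" unfolding Aeq(1) by (rule mat_trace_conj_diag[OF PQ(1,2,4)])
  moreover have "mat_trace B = (\<Sum>i<m. b i)" unfolding Beq(1) by (rule mat_trace_conj_diag[OF RS(1,2,4)])
  ultimately show ?thesis using that by blast
qed

text \<open>The upper bound holds for any two entries at distinct positions, so of the two largest
  only this distinctness is recorded. Their values may coincide.\<close>

lemma rev_sort_nth_01:
  fixes xs :: "'a :: linorder list"
  assumes "2 \<le> length xs"
  obtains p q where "p < length xs" "q < length xs" "p \<noteq> q" "rev (sort xs) ! 0 = xs ! p" "rev (sort xs) ! 1 = xs ! q"
proof -
  have "mset (rev (sort xs)) = mset xs" by simp
  then obtain f where f: "f permutes {..<length xs}" and eq: "permute_list f xs = rev (sort xs)"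
    by (rule mset_eq_permutation)
  have 0: "0 < length xs" and 1: "1 < length xs" using assms by auto
  have "f 0 < length xs" "f 1 < length xs" "f 0 \<noteq> f 1"
    using permutes_in_image[OF f] permutes_inj[OF f] assms by (auto dest: injD)
  moreover have "rev (sort xs) ! 0 = xs ! f 0" "rev (sort xs) ! 1 = xs ! f 1"
    unfolding eq[symmetric] by (rule permute_list_nth[OF f 0], rule permute_list_nth[OF f 1])
  ultimately show ?thesis by (rule that)
qed

section \<open>Inequalities for sums of two triples with total zero\<close>

text \<open>The indices 0, 1, 2 add up to 3, so \<open>3 - i - k\<close> is the remaining one, and
  the subtraction never truncates.\<close>

lemma sum_lessThan_3_distinct:
  fixes f :: "nat \<Rightarrow> 'a :: comm_monoid_add"
  assumes "i < 3" "k < 3" "i \<noteq> k"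
  shows "sum f {..<3} = f i + f k + f (3 - i - k)"
proof -
  have "i \<in> {0, 1, 2}" "k \<in> {0, 1, 2}" using assms by auto
  then show ?thesis using assms by (auto simp: numeral_3_eq_3 numeral_2_eq_2 ac_simps)
qed

lemma two_sums_same_row:
  fixes x y z u v w :: real
  assumes "x + y + z = 0" "u + v + w = 0"
  shows "(x + u)\<^sup>2 + (x + v)\<^sup>2 \<le> 2 * ((x\<^sup>2 + y\<^sup>2 + z\<^sup>2) + (u\<^sup>2 + v\<^sup>2 + w\<^sup>2))"
proof -
  have xw: "x = - y - z" "w = - u - v" using assms by auto
  \<comment> \<open>A sum of squares: the cross term \<open>- 2 * x * (u + v)\<close> equals
    \<open>2 * x * w\<close>, and twice the squares of \<open>y\<close> and \<open>z\<close> is the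
    square of \<open>y - z\<close> plus that of \<open>x = - (y + z)\<close>.\<close>
  have "2 * ((x\<^sup>2 + y\<^sup>2 + z\<^sup>2) + (u\<^sup>2 + v\<^sup>2 + w\<^sup>2)) - ((x + u)\<^sup>2 + (x + v)\<^sup>2)
      = (y - z)\<^sup>2 + (x + w)\<^sup>2 + w\<^sup>2 + u\<^sup>2 + v\<^sup>2"
    unfolding xw by (simp add: power2_eq_square algebra_simps)
  moreover have "\<dots> \<ge> 0" by simp
  ultimately show ?thesis by linarith
qed

lemma two_sums_le:
  fixes a b :: "nat \<Rightarrow> real"
  assumes a: "sum a {..<3} = 0" and b: "sum b {..<3} = 0"
    and "i < 3" "j < 3" "k < 3" "l < 3" "(i, j) \<noteq> (k, l)"
  shows "(a i + b j)\<^sup>2 + (a k + b l)\<^sup>2 \<le> 2 * ((\<Sum>i<3. (a i)\<^sup>2) + (\<Sum>i<3. (b i)\<^sup>2))"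
proof -
  have other: "\<exists>k<3. k \<noteq> i" for i :: nat
    by (cases "i = 0") (auto intro: exI[of _ 1] exI[of _ 0])
  consider "i = k" "j \<noteq> l" | "i \<noteq> k" "j = l" | "i \<noteq> k" "j \<noteq> l" using assms(7) by auto
  then show ?thesis
  proof cases
    case 1
    obtain r where r: "r < 3" "r \<noteq> i" using other by blast
    note sa = sum_lessThan_3_distinct[OF \<open>i < 3\<close> r(1) r(2)[symmetric]]
      and sb = sum_lessThan_3_distinct[OF \<open>j < 3\<close> \<open>l < 3\<close> 1(2)]
    show ?thesis using two_sums_same_row[OF a[unfolded sa] b[unfolded sb]]
      unfolding sa[of "\<lambda>i. (a i)\<^sup>2"] sb[of "\<lambda>i. (b i)\<^sup>2"] 1(1) by simp
  next
    \<comment> \<open>The same column: the row inequality with the roles of \<open>a\<close> and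
      \<open>b\<close> exchanged.\<close>
    case 2
    obtain r where r: "r < 3" "r \<noteq> j" using other by blast
    note sa = sum_lessThan_3_distinct[OF \<open>i < 3\<close> \<open>k < 3\<close> 2(1)]
      and sb = sum_lessThan_3_distinct[OF \<open>j < 3\<close> r(1) r(2)[symmetric]]
    show ?thesis using two_sums_same_row[OF b[unfolded sb] a[unfolded sa]]
      unfolding sa[of "\<lambda>i. (a i)\<^sup>2"] sb[of "\<lambda>i. (b i)\<^sup>2"] 2(2)
      by (simp add: add.commute)
  next
    case 3
    note sa = sum_lessThan_3_distinct[OF \<open>i < 3\<close> \<open>k < 3\<close> 3(1)]
      and sb = sum_lessThan_3_distinct[OF \<open>j < 3\<close> \<open>l < 3\<close> 3(2)]
    \<comment> \<open>In different rows and columns no eigenvalue occurs twice, so this can be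
      applied to each of the two sums separately.\<close>
    have "(x + y)\<^sup>2 \<le> 2 * (x\<^sup>2 + y\<^sup>2)" for x y :: real
      using zero_le_power2[of "x - y"] by (simp add: power2_eq_square algebra_simps)
    from this[of "a i" "b j"] this[of "a k" "b l"] show ?thesis
      unfolding sa[of "\<lambda>i. (a i)\<^sup>2"] sb[of "\<lambda>i. (b i)\<^sup>2"]
      using zero_le_power2[of "a (3 - i - k)"] zero_le_power2[of "b (3 - j - l)"]
      by (simp only: distrib_left)
  qed
qed

text \<open>Real and imaginary parts each have total zero, and squared moduli are the sums of their
  squares, so the real inequality is applied twice and added.\<close>

lemma two_cmod_sums_le:
  fixes a b :: "nat \<Rightarrow> complex"
  assumes a: "sum a {..<3} = 0" and b: "sum b {..<3} = 0"
    and "i < 3" "j < 3" "k < 3" "l < 3" "(i, j) \<noteq> (k, l)"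
  shows "(cmod (a i + b j))\<^sup>2 + (cmod (a k + b l))\<^sup>2 \<le> 2 * ((\<Sum>i<3. (cmod (a i))\<^sup>2) + (\<Sum>i<3. (cmod (b i))\<^sup>2))"
proof -
  have "(\<Sum>i<3. Re (a i)) = 0" "(\<Sum>i<3. Im (a i)) = 0" "(\<Sum>i<3. Re (b i)) = 0" "(\<Sum>i<3. Im (b i)) = 0"
    using a b by (simp_all flip: Re_sum Im_sum)
  from two_sums_le[OF this(1,3) assms(3-)] two_sums_le[OF this(2,4) assms(3-)]
  show ?thesis by (simp add: cmod_power2 sum.distrib)
qed

section \<open>The upper bound and the example for the lower bound\<close>

lemma chi3_singular_values_le:
  assumes "X \<in> chi3"
  shows "(singular_values X ! 0)\<^sup>2 + (singular_values X ! 1)\<^sup>2 \<le> 2 / 3"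
proof -
  obtain A B where A: "A \<in> carrier_mat 3 3" and B: "B \<in> carrier_mat 3 3" and X: "X = kron_sum A B"
    and trA: "mat_trace A = 0" and trB: "mat_trace B = 0"
    and norm: "mat_trace (mat_adjoint A * A) + mat_trace (mat_adjoint B * B) = 1 / 3"
    and N: "normal_mat (kron_sum A B)"
    using assms by (auto simp: chi3_def kron_sum_def)
  have "normal_mat A" "normal_mat B" using normal_kron_sum[OF A B N] by auto
  then obtain a b where
    "singular_values X = rev (sort (map (\<lambda>k. cmod (a (k div 3) + b (k mod 3))) [0..<3 * 3]))"
    and ab: "mat_trace A = sum a {..<3}" "mat_trace B = sum b {..<3}"
      "mat_trace (mat_adjoint A * A) = (\<Sum>i<3. complex_of_real ((cmod (a i))\<^sup>2))"
      "mat_trace (mat_adjoint B * B) = (\<Sum>i<3. complex_of_real ((cmod (b i))\<^sup>2))"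
    unfolding X by (rule singular_values_kron_sum_normal[OF A B])
  then have sv: "singular_values X = rev (sort (map (\<lambda>k. cmod (a (k div 3) + b (k mod 3))) [0..<9]))"
    and a: "sum a {..<3} = 0" and b: "sum b {..<3} = 0"
    using ab(1,2) trA trB by (simp, metis, metis)
  have "complex_of_real (\<Sum>i<3. (cmod (a i))\<^sup>2) + complex_of_real (\<Sum>i<3. (cmod (b i))\<^sup>2) = 1 / 3"
    using norm unfolding ab of_real_sum .
  then have "complex_of_real ((\<Sum>i<3. (cmod (a i))\<^sup>2) + (\<Sum>i<3. (cmod (b i))\<^sup>2)) = complex_of_real (1 / 3)"
    by (simp only: of_real_add of_real_divide of_real_1 of_real_numeral)
  then have sum: "(\<Sum>i<3. (cmod (a i))\<^sup>2) + (\<Sum>i<3. (cmod (b i))\<^sup>2) = 1 / 3"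
    by (simp only: of_real_eq_iff)
  let ?xs = "map (\<lambda>k. cmod (a (k div 3) + b (k mod 3))) [0..<9]"
  have "2 \<le> length ?xs" by simp
  then obtain p q where pq: "p < length ?xs" "q < length ?xs" "p \<noteq> q"
    "rev (sort ?xs) ! 0 = ?xs ! p" "rev (sort ?xs) ! 1 = ?xs ! q"
    by (rule rev_sort_nth_01)
  \<comment> \<open>Distinct flat positions are distinct cells of the 3 by 3 grid of sums.\<close>
  have "(p div 3, p mod 3) \<noteq> (q div 3, q mod 3)"
    using pq(3) by (metis Pair_inject div_mult_mod_eq)
  from two_cmod_sums_le[OF a b _ _ _ _ this] show ?thesis
    unfolding sv pq(4,5) using pq(1,2) sum by auto
qed

lemma chi3_singular_values_attained:
  obtains X where "X \<in> chi3" "(singular_values X ! 0)\<^sup>2 + (singular_values X ! 1)\<^sup>2 = 5 / 9"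
proof -
  \<comment> \<open>The squares of 4, -2, -2 and of 1, 1, -2 add up to 24 + 6 = 30, so the total 1/3
    requires \<open>y\<^sup>2 = 1 / 90\<close>.\<close>
  define y :: real where "y = sqrt (1 / 90)"
  have y: "y > 0" "y\<^sup>2 = 1 / 90" by (simp_all add: y_def)
  define a :: "nat \<Rightarrow> real" where "a = (\<lambda>i. if i = 0 then 4 * y else - 2 * y)"
  define b :: "nat \<Rightarrow> real" where "b = (\<lambda>i. if i = 2 then - 2 * y else y)"
  define A where "A = mat_diag 3 (\<lambda>i. complex_of_real (a i))"
  define B where "B = mat_diag 3 (\<lambda>i. complex_of_real (b i))"
  define d where "d = (\<lambda>k. complex_of_real (a (k div 3) + b (k mod 3)))"
  have AB: "A \<in> carrier_mat 3 3" "B \<in> carrier_mat 3 3" by (simp_all add: A_def B_def)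
  have X: "kron_sum A B = mat_diag 9 d"
    unfolding A_def B_def d_def by (simp add: kron_sum_mat_diag)
  have adj: "mat_adjoint (mat_diag n (\<lambda>i. complex_of_real (f i))) = mat_diag n (\<lambda>i. complex_of_real (f i))" for n f
    by (simp add: mat_adjoint_mat_diag)
  have tr: "mat_trace (mat_diag n f) = sum f {..<n}" for n and f :: "nat \<Rightarrow> complex"
    by (simp add: mat_trace_def mat_diag_def)
  have three: "{..<3} = {0, 1, 2 :: nat}" by auto
  have "mat_trace A = 0" "mat_trace B = 0"
    unfolding A_def B_def tr by (simp_all add: three a_def b_def)
  moreover have "mat_trace (mat_adjoint A * A) + mat_trace (mat_adjoint B * B) = complex_of_real (30 * y\<^sup>2)"
    unfolding A_def B_def adj mat_diag_diag tr
    by (simp add: three a_def b_def power2_eq_square)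
  then have "mat_trace (mat_adjoint A * A) + mat_trace (mat_adjoint B * B) = 1 / 3"
    by (simp add: y)
  moreover have "normal_mat (kron_sum A B)" "kron_sum A B \<in> carrier_mat 9 9"
    unfolding X by (simp_all add: normal_mat_def mat_adjoint_mat_diag mult.commute)
  ultimately have chi: "kron_sum A B \<in> chi3"
    using AB by (auto simp: chi3_def kron_sum_def)
  have "singular_values (kron_sum A B) = rev (sort (map (\<lambda>i. cmod (d i)) [0..<9]))"
    by (rule singular_values_diagonalized[of "1\<^sub>m 9" 9 "1\<^sub>m 9"])
      (simp_all add: X mat_adjoint_mat_diag)
  \<comment> \<open>The two largest moduli, both \<open>5 * y\<close>, come from the row of the
    eigenvalue \<open>4 * y\<close>; their squares give 50/90 = 5/9.\<close>
  also have "map (\<lambda>i. cmod (d i)) [0..<9] = [5 * y, 5 * y, 2 * y, y, y, 4 * y, y, y, 4 * y]"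
    unfolding d_def norm_of_real using y(1) by (simp add: upt_rec a_def b_def)
  also have "sort \<dots> = [y, y, y, y, 2 * y, 4 * y, 4 * y, 5 * y, 5 * y]"
    using y(1) by (intro properties_for_sort) auto
  finally have "(singular_values (kron_sum A B) ! 0)\<^sup>2 + (singular_values (kron_sum A B) ! 1)\<^sup>2 = 5 / 9"
    by (simp add: power_mult_distrib y)
  with chi show ?thesis by (rule that)
qed

text \<open>The supremum is taken in the complete lattice \<open>ereal\<close>, where it behaves as
  a least upper bound without side conditions of nonemptiness or boundedness.\<close>

theorem lemma11:
  shows "ereal (5 / 9) \<le> (SUP X\<in>chi3. ereal ((singular_values X ! 0)\<^sup>2 + (singular_values X ! 1)\<^sup>2))
    \<and> (SUP X\<in>chi3. ereal ((singular_values X ! 0)\<^sup>2 + (singular_values X ! 1)\<^sup>2)) \<le> ereal (2 / 3)"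
proof
  obtain X where "X \<in> chi3" "(singular_values X ! 0)\<^sup>2 + (singular_values X ! 1)\<^sup>2 = 5 / 9"
    by (rule chi3_singular_values_attained)
  then show "ereal (5 / 9) \<le> (SUP X\<in>chi3. ereal ((singular_values X ! 0)\<^sup>2 + (singular_values X ! 1)\<^sup>2))"
    by (metis (mono_tags, lifting) SUP_upper)
  show "(SUP X\<in>chi3. ereal ((singular_values X ! 0)\<^sup>2 + (singular_values X ! 1)\<^sup>2)) \<le> ereal (2 / 3)"
    by (intro SUP_least) (use chi3_singular_values_le in simp)
qed

end
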